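(* Let $S$ be an inverse semigroup, $K$ a commutative ring with unit, and let $V$ be a non-zero $KS$-module. Then $V$ is a spectral $K\mathscr G(S)$-module if and only if there exists $v\in V$ such that $fv=v$ for some idempotent $f\in E(S)$ and, for all $e\in E(S)$, one has $ev\neq0$ if and only if $ev=v$. In particular, if $\varphi\colon S\to\mathrm{End}_K(V)$ is the corresponding representation and $\varphi(E(S))$ contains a primitive idempotent (for instance, if it satisfies the descending chain condition), then $V$ is spectral.
   Context: An inverse semigroup is a semigroup $S$ such that each $s\in S$ has a unique $s^*$ with $ss^*s=s$, $s^*ss^*=s^*$. $E(S)$ is its commutative semigroup of idempotents, ordered by $e\le f$ iff $ef=e$; $s\le t$ iff $s=et$ for some $e\in E(S)$. An idempotent of $\varphi(E(S))$ is primitive if it is minimal among the non-zero idempotents there. Modules $V$ over a $K$-algebra $A$ are assumed non-degenerate, i.e. $AV=V$. $\widehat{E(S)}$ is the space of non-zero semilattice homomorphisms $\theta\colon E(S)\to\{0,1\}$ with the subspace topology from $\{0,1\}^{E(S)}$; $D(e)=\{\theta\mid\theta(e)=1\}$. Each $s\in S$ acts by the homeomorphism $D(s^*s)\to D(ss^* )$, $(s\theta)(e)=\theta(s^*es)$. The universal groupoid $\mathscr G=\mathscr G(S)$ is the set of classes $[s,\theta]$ of pairs with $\theta\in D(s^*s)$, where $(s,\theta)\sim(t,\theta')$ iff $\theta=\theta'$ and there is $u\le s,t$ with $\theta\in D(u^*u)$. It has basic open sets $(s,U)=\{[s,\theta]\mid\theta\in U\}$ ($U\subseteq D(s^*s)$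 open), product $[s,\theta][t,\theta']=[st,\theta']$ defined iff $t\theta'=\theta$, $d([s,\theta])=\theta$, $r([s,\theta])=s\theta$, unit space $\mathscr G^0=\widehat{E(S)}$. With $K$ discrete, $K\mathscr G$ is the $K$-module of functions $\mathscr G\to K$ spanned by those $f$ for which there is an open Hausdorff subspace $V$ such that $f$ vanishes off $V$ and $f|_V$ is continuous with compact support, with product $f\ast g(x)=\sum_{y\in d^{-1}(d(x))}f(xy^{-1})g(y)$. The map $s\mapsto\chi_{(s,D(s^*s))}$ extends to a $K$-algebra isomorphism $KS\to K\mathscr G(S)$ (so $e\mapsto\chi_{D(e)}$ for $e\in E(S)$), through which $KS$-modules are viewed as $K\mathscr G(S)$-modules. For a $K\mathscr G$-module $V$ and $\theta\in\mathscr G^0$, $\mathrm{Res}_\theta(V)=\bigcap_U\chi_UV$, over all compact open $U\subseteq\mathscr G^0$ containing $\theta$; a non-zero $V$ is spectral if $\mathrm{Res}_\theta(V)\neq0$ for some $\theta$. *)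

theory Defs
  imports "HOL-Analysis.Analysis" "HOL-Library.Poly_Mapping"
begin

section \<open>Inverse semigroups\<close>

class inverse_semigroup = semigroup_mult +
  assumes ex1_star: "\<exists>!t. s * t * s = s \<and> t * s * t = t"

definition star :: "'s::inverse_semigroup \<Rightarrow> 's" where
  "star s = (THE t. s * t * s = s \<and> t * s * t = t)"

definition idems :: "'s::inverse_semigroup set" where
  "idems = {e. e * e = e}"

definition nat_le :: "'s::inverse_semigroup \<Rightarrow> 's \<Rightarrow> bool" where
  "nat_le s t \<longleftrightarrow> (\<exists>e\<in>idems. s = e * t)"


section \<open>The spectrum of the semilattice of idempotents\<close>

text \<open>Characters take values in \<^typ>\<open>bool\<close>, with \<^const>\<open>True\<close> for 1 and conjunction for the
  product of \<open>{0,1}\<close>. Being defined on \<^term>\<open>idems\<close> only, they are taken \<^const>\<open>extensional\<close>,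
  as are the points of the product topology \<open>{0,1}\<^sup>E\<close>.\<close>

definition spectrum :: "('s::inverse_semigroup \<Rightarrow> bool) set" where
  "spectrum = {\<theta> \<in> extensional idems.
     (\<forall>e\<in>idems. \<forall>f\<in>idems. \<theta> (e * f) = (\<theta> e \<and> \<theta> f)) \<and> (\<exists>e\<in>idems. \<theta> e)}"

definition spectrum_top :: "('s::inverse_semigroup \<Rightarrow> bool) topology" where
  "spectrum_top =
     subtopology (product_topology (\<lambda>_. discrete_topology UNIV) idems) spectrum"

definition basicD :: "'s::inverse_semigroup \<Rightarrow> ('s \<Rightarrow> bool) set" where
  "basicD e = {\<theta> \<in> spectrum. \<theta> e}"

definition sact :: "'s::inverse_semigroup \<Rightarrow> ('s \<Rightarrow> bool) \<Rightarrow> ('s \<Rightarrow> bool)" where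
  "sact s \<theta> = restrict (\<lambda>e. \<theta> (star s * e * s)) idems"


section \<open>The universal groupoid\<close>

type_synonym 's arrow = "('s \<times> ('s \<Rightarrow> bool)) set"

definition germ_pairs :: "('s::inverse_semigroup \<times> ('s \<Rightarrow> bool)) set" where
  "germ_pairs = {(s, \<theta>). \<theta> \<in> basicD (star s * s)}"

definition germ_rel ::
    "(('s::inverse_semigroup \<times> ('s \<Rightarrow> bool)) \<times> ('s \<times> ('s \<Rightarrow> bool))) set" where
  "germ_rel = {((s, \<theta>), (t, \<theta>')). (s, \<theta>) \<in> germ_pairs \<and> (t, \<theta>') \<in> germ_pairs \<and> \<theta> = \<theta>' \<and>
     (\<exists>u. nat_le u s \<and> nat_le u t \<and> \<theta> \<in> basicD (star u * u))}"

definition univ_groupoid :: "'s::inverse_semigroup arrow set" where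
  "univ_groupoid = germ_pairs // germ_rel"

definition germ :: "'s::inverse_semigroup \<Rightarrow> ('s \<Rightarrow> bool) \<Rightarrow> 's arrow" where
  "germ s \<theta> = germ_rel `` {(s, \<theta>)}"

definition gdom :: "'s::inverse_semigroup arrow \<Rightarrow> ('s \<Rightarrow> bool)" where
  "gdom x = (THE \<theta>. \<exists>s. (s, \<theta>) \<in> x)"

definition grange :: "'s::inverse_semigroup arrow \<Rightarrow> ('s \<Rightarrow> bool)" where
  "grange x = (THE \<eta>. \<exists>s \<theta>. (s, \<theta>) \<in> x \<and> \<eta> = sact s \<theta>)"

text \<open>Only meaningful when \<^term>\<open>gdom x = grange y\<close>.\<close>

definition gmult :: "'s::inverse_semigroup arrow \<Rightarrow> 's arrow \<Rightarrow> 's arrow" where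
  "gmult x y = (THE z. \<exists>s t \<theta>. (s, sact t \<theta>) \<in> x \<and> (t, \<theta>) \<in> y \<and> z = germ (s * t) \<theta>)"

definition ginv :: "'s::inverse_semigroup arrow \<Rightarrow> 's arrow" where
  "ginv x = (THE y. \<exists>s \<theta>. (s, \<theta>) \<in> x \<and> y = germ (star s) (sact s \<theta>))"

definition basic_set :: "'s::inverse_semigroup \<Rightarrow> ('s \<Rightarrow> bool) set \<Rightarrow> 's arrow set" where
  "basic_set s U = germ s ` U"

definition groupoid_top :: "'s::inverse_semigroup arrow topology" where
  "groupoid_top = topology_generated_by
     {basic_set s U | s U. openin spectrum_top U \<and> U \<subseteq> basicD (star s * s)}"

text \<open>The unit space is identified with the spectrum: \<open>\<theta>\<close> corresponds to the germ \<open>[e,\<theta>]\<close>, for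
  any idempotent \<open>e\<close> with \<open>\<theta>(e) = 1\<close>.\<close>

definition units :: "('s::inverse_semigroup \<Rightarrow> bool) set \<Rightarrow> 's arrow set" where
  "units U = {germ e \<theta> | e \<theta>. e \<in> idems \<and> \<theta> \<in> U \<and> \<theta> \<in> basicD e}"


section \<open>The groupoid algebra\<close>

text \<open>Functions on the groupoid are functions on the type of arrows that vanish off
  \<^term>\<open>univ_groupoid\<close>.\<close>

definition groupoid_algebra_gens :: "('s::inverse_semigroup arrow \<Rightarrow> 'k::comm_ring_1) set" where
  "groupoid_algebra_gens = {f. \<exists>V. openin groupoid_top V \<and>
     Hausdorff_space (subtopology groupoid_top V) \<and>
     (\<forall>x. x \<notin> V \<longrightarrow> f x = 0) \<and>
     continuous_map (subtopology groupoid_top V) (discrete_topology UNIV) f \<and>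
     compactin (subtopology groupoid_top V)
       (subtopology groupoid_top V closure_of {x \<in> V. f x \<noteq> 0})}"

definition groupoid_algebra :: "('s::inverse_semigroup arrow \<Rightarrow> 'k::comm_ring_1) set" where
  "groupoid_algebra =
     {\<lambda>x. \<Sum>f\<in>F. c f * f x | F c. finite F \<and> F \<subseteq> groupoid_algebra_gens}"

text \<open>For \<open>f\<close> and \<open>g\<close> in the groupoid algebra, all but finitely many terms of the sum vanish; it
  is restricted to the others because sums over infinite sets are 0 by convention.\<close>

definition convolution ::
    "('s::inverse_semigroup arrow \<Rightarrow> 'k::comm_ring_1) \<Rightarrow> ('s arrow \<Rightarrow> 'k) \<Rightarrow> ('s arrow \<Rightarrow> 'k)" where
  "convolution f g x = (if x \<in> univ_groupoid then
     (\<Sum>y\<in>{y \<in> univ_groupoid. gdom y = gdom x \<and> f (gmult x (ginv y)) * g y \<noteq> 0}.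
        f (gmult x (ginv y)) * g y) else 0)"


section \<open>The semigroup algebra and its modules\<close>

text \<open>The library's product on finitely supported functions is for additively written monoids.\<close>

definition sg_mult ::
    "('s::inverse_semigroup \<Rightarrow>\<^sub>0 'k::comm_ring_1) \<Rightarrow> ('s \<Rightarrow>\<^sub>0 'k) \<Rightarrow> ('s \<Rightarrow>\<^sub>0 'k)" where
  "sg_mult a b = (\<Sum>s\<in>Poly_Mapping.keys a. \<Sum>t\<in>Poly_Mapping.keys b.
     Poly_Mapping.single (s * t) (Poly_Mapping.lookup a s * Poly_Mapping.lookup b t))"

definition sg_scale :: "'k::comm_ring_1 \<Rightarrow> ('s::inverse_semigroup \<Rightarrow>\<^sub>0 'k) \<Rightarrow> ('s \<Rightarrow>\<^sub>0 'k)" where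
  "sg_scale k a = Poly_Mapping.map ((*) k) a"

abbreviation sg_elem :: "'s::inverse_semigroup \<Rightarrow> ('s \<Rightarrow>\<^sub>0 'k::comm_ring_1)" where
  "sg_elem s \<equiv> Poly_Mapping.single s 1"

locale semigroup_algebra_module = module scale
  for scale :: "'k::comm_ring_1 \<Rightarrow> 'v::ab_group_add \<Rightarrow> 'v" +
  fixes act :: "('s::inverse_semigroup \<Rightarrow>\<^sub>0 'k) \<Rightarrow> 'v \<Rightarrow> 'v"
  assumes act_add_left: "act (a + b) v = act a v + act b v"
    and act_add_right: "act a (v + w) = act a v + act a w"
    and act_scale_left: "act (sg_scale k a) v = scale k (act a v)"
    and act_scale_right: "act a (scale k v) = scale k (act a v)"
    and act_mult: "act (sg_mult a b) v = act a (act b v)"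
    and nondegenerate: "module.span scale {act a v | a v. True} = UNIV"

definition sg_rep ::
    "(('s::inverse_semigroup \<Rightarrow>\<^sub>0 'k::comm_ring_1) \<Rightarrow> 'v \<Rightarrow> 'v) \<Rightarrow> 's \<Rightarrow> 'v \<Rightarrow> 'v" where
  "sg_rep act s = act (sg_elem s)"

text \<open>The linear extension of \<open>s \<mapsto> \<chi>\<^bsub>(s, D(s*s))\<^esub>\<close>; it is an algebra isomorphism onto
  \<^const>\<open>groupoid_algebra\<close> with the product \<^const>\<open>convolution\<close>.\<close>

definition sg_iso ::
    "('s::inverse_semigroup \<Rightarrow>\<^sub>0 'k::comm_ring_1) \<Rightarrow> ('s arrow \<Rightarrow> 'k)" where
  "sg_iso a = (\<lambda>x. \<Sum>s\<in>Poly_Mapping.keys a.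
     Poly_Mapping.lookup a s * indicator (basic_set s (basicD (star s * s))) x)"

text \<open>The action of the groupoid algebra on a module over the semigroup algebra.\<close>

definition groupoid_act ::
    "(('s::inverse_semigroup \<Rightarrow>\<^sub>0 'k::comm_ring_1) \<Rightarrow> 'v \<Rightarrow> 'v) \<Rightarrow> ('s arrow \<Rightarrow> 'k) \<Rightarrow> 'v \<Rightarrow> 'v" where
  "groupoid_act act f = act (inv_into UNIV sg_iso f)"


section \<open>Restriction and spectral modules\<close>

definition Res ::
    "(('s::inverse_semigroup arrow \<Rightarrow> 'k::comm_ring_1) \<Rightarrow> 'v \<Rightarrow> 'v) \<Rightarrow> ('s \<Rightarrow> bool) \<Rightarrow> 'v set" where
  "Res gact \<theta> =
     (\<Inter>U\<in>{U. openin spectrum_top U \<and> compactin spectrum_top U \<and> \<theta> \<in> U}.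
        range (gact (indicator (units U))))"

definition spectral ::
    "(('s::inverse_semigroup arrow \<Rightarrow> 'k::comm_ring_1) \<Rightarrow> 'v::ab_group_add \<Rightarrow> 'v) \<Rightarrow> bool" where
  "spectral gact \<longleftrightarrow> (\<exists>v::'v. v \<noteq> 0) \<and> (\<exists>\<theta>\<in>spectrum. Res gact \<theta> \<noteq> {0})"


section \<open>Idempotent operators\<close>

definition op_le :: "('v \<Rightarrow> 'v) \<Rightarrow> ('v \<Rightarrow> 'v) \<Rightarrow> bool" where
  "op_le p q \<longleftrightarrow> p \<circ> q = p"

definition primitive_in :: "('v::zero \<Rightarrow> 'v) set \<Rightarrow> ('v \<Rightarrow> 'v) \<Rightarrow> bool" where
  "primitive_in P p \<longleftrightarrow> p \<in> P \<and> p \<noteq> (\<lambda>_. 0) \<and>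
     (\<forall>q\<in>P. q \<noteq> (\<lambda>_. 0) \<and> op_le q p \<longrightarrow> q = p)"

definition descending_chain_condition :: "('v \<Rightarrow> 'v) set \<Rightarrow> bool" where
  "descending_chain_condition P \<longleftrightarrow>
     \<not> (\<exists>c :: nat \<Rightarrow> 'v \<Rightarrow> 'v. \<forall>n. c n \<in> P \<and> op_le (c (Suc n)) (c n) \<and> c (Suc n) \<noteq> c n)"

end

theory Submission
  imports Defs
begin

text \<open>
  A vector \<open>v\<close> with \<open>ev \<in> {0, v}\<close> for all idempotents \<open>e\<close>, not all \<open>ev\<close> being zero, determines
  the character \<open>\<theta>(e) = 1 \<longleftrightarrow> ev = v\<close>. A compact open set \<open>U\<close> is a finite union of sets
  \<open>D(e) - (D(f\<^sub>1) \<union> \<dots> \<union> D(f\<^sub>n))\<close>, so \<open>\<chi>\<^sub>U\<close> is a linear combination of functions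
  \<open>\<chi>\<^bsub>D(e)\<^esub>\<close>, hence acts on \<open>v\<close> as the scalar \<open>\<chi>\<^sub>U(\<theta>)\<close>; thus \<open>v \<in> Res\<^sub>\<theta>(V)\<close>. Conversely the compact open
  sets \<open>D(e)\<close> and \<open>D(f) - D(e)\<close> show that any \<open>v \<noteq> 0\<close> in \<open>Res\<^sub>\<theta>(V)\<close> has this property. If \<open>\<phi>(f)\<close> is
  primitive, any \<open>v \<noteq> 0\<close> in its image does.
\<close>

section \<open>Inverse semigroups\<close>

lemma star_inverse:
  fixes s :: "'s::inverse_semigroup"
  shows "s * star s * s = s" "star s * s * star s = star s"
  using theI'[OF ex1_star[of s]] by (simp_all add: star_def)

lemma star_inverse_left: "star s * (s * (star s * x)) = star s * x"
  by (simp add: star_inverse flip: mult.assoc)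

lemma star_eqI:
  fixes s :: "'s::inverse_semigroup"
  assumes "s * t * s = s" "t * s * t = t"
  shows "star s = t"
  using ex1_star[of s] star_inverse[of s] assms by blast

lemma star_idem: "e \<in> idems \<Longrightarrow> star e = e"
  by (intro star_eqI) (simp_all add: idems_def)

lemma idems_left_cancel: "e \<in> idems \<Longrightarrow> e * (e * x) = e * x"
  by (simp add: idems_def flip: mult.assoc)

text \<open>Let x be \<open>star (e * f)\<close>. Then fxe is an inverse of ef as well, so x = fxe
  by uniqueness, and this is idempotent. Hence x is its own inverse; as ef is also an inverse of x,
  ef = x.\<close>

lemma idems_mult:
  assumes "e \<in> idems" "f \<in> idems"
  shows "e * f \<in> idems"
proof -
  define x where "x = star (e * f)"
  have x: "e * (f * (x * (e * f))) = e * f" "x * (e * (f * x)) = x"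
    using star_inverse[of "e * f"] by (simp_all add: x_def mult.assoc)
  \<comment> \<open>Products are normalised to the right, so the relation is also needed with an
    arbitrary tail y.\<close>
  have x': "x * (e * (f * (x * y))) = x * y" for y
    using arg_cong[OF x(2), of "\<lambda>z. z * y"] by (simp add: mult.assoc)
  note cancel = idems_left_cancel[OF assms(1)] idems_left_cancel[OF assms(2)]
  have "star (e * f) = f * x * e"
    by (rule star_eqI) (simp_all add: mult.assoc cancel x x')
  moreover have "(f * x * e) * (f * x * e) = f * x * e"
    by (simp add: mult.assoc x')
  ultimately have "x * x = x"
    by (metis x_def)
  then have "star x = x" by (intro star_eqI) simp_all
  moreover have "star x = e * f"
    by (rule star_eqI) (simp_all add: mult.assoc x)
  ultimately have "e * f = x" by metis
  then show ?thesis using \<open>x * x = x\<close> by (simp only: idems_def mem_Collect_eq)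
qed

text \<open>Both ef and fe are idempotent, so fe is an inverse of ef; but ef is its own
  inverse.\<close>

lemma idems_commute:
  assumes "e \<in> idems" "f \<in> idems"
  shows "e * f = f * e"
proof -
  have ef: "e * f * (e * f) = e * f" "f * e * (f * e) = f * e"
    using idems_mult[OF assms] idems_mult[OF assms(2,1)] by (simp_all add: idems_def)
  have "star (e * f) = f * e"
    by (rule star_eqI)
      (use ef in \<open>simp_all add: mult.assoc idems_left_cancel assms\<close>)
  then show ?thesis
    using star_idem[OF idems_mult[OF assms]] by simp
qed

lemma star_mult_idem: "star s * s \<in> idems" and mult_star_idem: "s * star s \<in> idems"
  by (simp_all add: idems_def star_inverse flip: mult.assoc)

lemma nat_le_refl: "nat_le s s"
  unfolding nat_le_def using mult_star_idem star_inverse(1) by metis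

lemma nat_le_trans: "nat_le s t \<Longrightarrow> nat_le t u \<Longrightarrow> nat_le s u"
  unfolding nat_le_def by (metis idems_mult mult.assoc)

lemma nat_le_antisym: "nat_le s t \<Longrightarrow> nat_le t s \<Longrightarrow> s = t"
  unfolding nat_le_def by (metis idems_commute idems_left_cancel mult.assoc)

lemma nat_le_idem: "nat_le u e \<Longrightarrow> e \<in> idems \<Longrightarrow> u \<in> idems"
  unfolding nat_le_def using idems_mult by blast

text \<open>If u = es, then \<open>star u * u\<close> is \<open>star s * e * s\<close>. Lying above
  \<open>star s * s\<close>, it equals it, and multiplying by s on the left gives es = s.\<close>

lemma nat_le_eqI:
  assumes "nat_le u s" and le: "(star s * s) * (star u * u) = star s * s"
  shows "u = s"
proof -
  obtain e where e: "e \<in> idems" "u = e * s"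
    using assms(1) by (auto simp: nat_le_def)
  have comm: "s * (star s * e) = e * (s * star s)"
    using idems_commute[OF mult_star_idem e(1), of s] by (simp add: mult.assoc)
  have comm': "s * (star s * (e * y)) = e * (s * (star s * y))" for y
    using arg_cong[OF comm, of "\<lambda>z. z * y"] by (simp add: mult.assoc)
  have star3: "s * (star s * s) = s" "star s * (s * star s) = star s"
    using star_inverse[of s] by (simp_all only: mult.assoc)
  have comm'': "star s * (e * (s * star s)) = star s * e"
    by (simp add: star_inverse_left flip: comm)
  have "star u = star s * e"
    unfolding e(2)
    by (rule star_eqI)
      (simp_all add: mult.assoc comm' comm comm'' star3 star_inverse_left idems_left_cancel e(1))
  then have "star s * (e * s) = star s * s"
    using le e by (simp add: mult.assoc star_inverse_left idems_left_cancel)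
  then have "e * s = s"
    by (metis comm' star3(1))
  then show ?thesis using e by simp
qed

section \<open>Characters and germs\<close>

lemma spectrum_mult: "\<theta> \<in> spectrum \<Longrightarrow> e \<in> idems \<Longrightarrow> f \<in> idems \<Longrightarrow> \<theta> (e * f) \<longleftrightarrow> \<theta> e \<and> \<theta> f"
  by (auto simp: spectrum_def)

lemma basicD_mult: "e \<in> idems \<Longrightarrow> f \<in> idems \<Longrightarrow> basicD (e * f) = basicD e \<inter> basicD f"
  by (auto simp: basicD_def spectrum_mult)

lemma basicD_subset: "basicD e \<subseteq> spectrum"
  by (auto simp: basicD_def)

lemma basicD_star_idem: "e \<in> idems \<Longrightarrow> basicD (star e * e) = basicD e"
  by (simp add: star_idem) (simp add: idems_def)

lemma germ_pairs_idem: "e \<in> idems \<Longrightarrow> (e, \<theta>) \<in> germ_pairs \<longleftrightarrow> \<theta> \<in> basicD e"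
  by (simp add: germ_pairs_def basicD_star_idem)

lemma germ_self: "\<theta> \<in> basicD (star s * s) \<Longrightarrow> (s, \<theta>) \<in> germ s \<theta>"
  by (auto simp: germ_def germ_rel_def germ_pairs_def intro: nat_le_refl)

lemma germ_eqD:
  assumes "germ s \<theta> = germ t \<eta>" "\<theta> \<in> basicD (star s * s)"
  shows "\<theta> = \<eta> \<and> (\<exists>u. nat_le u s \<and> nat_le u t \<and> \<theta> \<in> basicD (star u * u))"
  using germ_self[OF assms(2)] unfolding assms(1) by (auto simp: germ_def germ_rel_def)

text \<open>If u witnesses that (e, \<theta>) and (t, \<theta>) are equivalent, then fu witnesses it
  for (f, \<theta>) and (t, \<theta>).\<close>

lemma germ_idem_subset:
  assumes "e \<in> idems" "f \<in> idems" "\<theta> \<in> basicD e" "\<theta> \<in> basicD f"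
  shows "germ e \<theta> \<subseteq> germ f \<theta>"
proof
  fix x assume "x \<in> germ e \<theta>"
  then obtain t u where x: "x = (t, \<theta>)" "(t, \<theta>) \<in> germ_pairs"
    and u: "nat_le u e" "nat_le u t" "\<theta> \<in> basicD (star u * u)"
    by (auto simp: germ_def germ_rel_def)
  have ui: "u \<in> idems" using nat_le_idem[OF u(1) assms(1)] .
  have fu: "f * u \<in> idems" "f * u = u * f"
    using idems_mult idems_commute assms(2) ui by auto
  have "nat_le (f * u) f" using fu ui by (auto simp: nat_le_def)
  moreover have "nat_le (f * u) t"
    using u(2) assms(2) by (auto simp: nat_le_def mult.assoc[symmetric] intro: idems_mult)
  moreover have "\<theta> \<in> basicD (star (f * u) * (f * u))"
    using u(3) ui fu(1) assms by (simp add: basicD_star_idem basicD_mult)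
  ultimately show "x \<in> germ f \<theta>"
    using x assms by (auto simp: germ_def germ_rel_def germ_pairs_idem)
qed

lemma germ_idem_eq:
  "\<lbrakk>e \<in> idems; f \<in> idems; \<theta> \<in> basicD e; \<theta> \<in> basicD f\<rbrakk> \<Longrightarrow> germ e \<theta> = germ f \<theta>"
  by (intro subset_antisym germ_idem_subset)

text \<open>\<open>units\<close> admits every idempotent defined at \<theta>,
  \<open>basic_set\<close> only e; since these germs agree, \<open>sg_iso\<close> sends e to the
  characteristic function of D(e) in the unit space.\<close>

lemma basic_set_idem: "e \<in> idems \<Longrightarrow> basic_set e (basicD (star e * e)) = units (basicD e)"
  by (auto simp: basicD_star_idem basic_set_def units_def image_iff) (metis germ_idem_eq)

lemma germ_idem_eqD: "germ e \<theta> = germ t \<eta> \<Longrightarrow> e \<in> idems \<Longrightarrow> \<theta> \<in> basicD e \<Longrightarrow> \<theta> = \<eta>"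
  using germ_eqD[of e \<theta>] by (simp add: basicD_star_idem)

lemma germ_in_units_iff:
  assumes "e \<in> idems" "\<theta> \<in> basicD e"
  shows "germ e \<theta> \<in> units U \<longleftrightarrow> \<theta> \<in> U"
  using assms by (auto simp: units_def dest: germ_idem_eqD)

lemma unitsE:
  assumes "x \<in> units U"
  obtains e \<theta> where "e \<in> idems" "\<theta> \<in> basicD e" "x = germ e \<theta>" "\<theta> \<in> U"
  using assms by (auto simp: units_def)

text \<open>A unit germ determines its point, so \<open>units\<close> respects Boolean
  operations.\<close>

lemma units_Int: "units (U \<inter> V) = units U \<inter> units V"
  by (auto elim!: unitsE simp: germ_in_units_iff dest: germ_idem_eqD)

lemma units_Diff: "units (U - V) = units U - units V"
  by (auto elim!: unitsE simp: germ_in_units_iff dest: germ_idem_eqD)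

lemma units_Un: "units (U \<union> V) = units U \<union> units V"
  by (auto simp: units_def)

section \<open>Injectivity of the comparison map\<close>

lemma sg_iso_superset:
  assumes "finite A" "Poly_Mapping.keys a \<subseteq> A"
  shows "sg_iso a x = (\<Sum>s\<in>A. Poly_Mapping.lookup a s * indicator (basic_set s (basicD (star s * s))) x)"
  unfolding sg_iso_def
  by (rule sum.mono_neutral_left) (use assms in \<open>auto simp: in_keys_iff\<close>)

lemma sg_iso_add: "sg_iso (a + b) x = sg_iso a x + sg_iso b x"
proof -
  let ?A = "Poly_Mapping.keys a \<union> Poly_Mapping.keys b"
  note iso = sg_iso_superset[of ?A]
  show ?thesis
    using Poly_Mapping.keys_add[of a b]
    by (simp add: iso lookup_add distrib_right sum.distrib)
qed

lemma sg_iso_diff: "sg_iso (a - b) x = sg_iso a x - sg_iso b x"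
  using sg_iso_add[of "a - b" b x] by (simp add: algebra_simps)

lemma sg_iso_zero: "sg_iso 0 x = 0"
  by (simp add: sg_iso_def)

lemma sg_iso_sum: "sg_iso (sum f A) x = (\<Sum>i\<in>A. sg_iso (f i) x)"
  by (induction A rule: infinite_finite_induct) (simp_all add: sg_iso_zero sg_iso_add)

lemma sg_iso_single:
  "sg_iso (Poly_Mapping.single s c) x = c * indicator (basic_set s (basicD (star s * s))) x"
  by (subst sg_iso_superset[of "{s}"], simp, simp, subst sum.insert) (simp_all add: lookup_single)

text \<open>The character of the principal filter of e: it is true exactly at the idempotents above
  e.\<close>

definition principal_char :: "'s::inverse_semigroup \<Rightarrow> 's \<Rightarrow> bool" where
  "principal_char e = restrict (\<lambda>f. e * f = e) idems"

lemma principal_char_spectrum: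
  assumes "e \<in> idems"
  shows "principal_char e \<in> spectrum"
proof -
  have absorb: "e * g = e" if "e * (f * g) = e" "g \<in> idems" for f g
  proof -
    have "e * (f * g) = e * g"
      using arg_cong[OF that(1), of "\<lambda>z. z * g"] that(2) by (simp add: mult.assoc idems_def)
    then show ?thesis using that(1) by simp
  qed
  have "e * (f * g) = e \<longleftrightarrow> e * f = e \<and> e * g = e" if fg: "f \<in> idems" "g \<in> idems" for f g
  proof
    assume "e * (f * g) = e"
    then show "e * f = e \<and> e * g = e"
      using absorb[of f g] absorb[of g f] fg by (simp add: idems_commute)
  next
    assume "e * f = e \<and> e * g = e"
    then show "e * (f * g) = e"
      by (simp flip: mult.assoc)
  qed
  moreover have "e * e = e" using assms by (simp add: idems_def)
  ultimately show ?thesis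
    using assms by (auto simp: spectrum_def principal_char_def idems_mult)
qed

lemma principal_char_basicD: "principal_char (star s * s) \<in> basicD (star s * s)"
  using principal_char_spectrum[OF star_mult_idem, of s] star_mult_idem[of s]
  by (auto simp: basicD_def principal_char_def idems_def)

text \<open>Equality with a germ of t gives u below s and t with \<open>star u * u\<close> in the
  principal filter of \<open>star s * s\<close>. By \<open>nat_le_eqI\<close>, u = s.\<close>

lemma principal_germ_in_basic_set:
  assumes "germ s (principal_char (star s * s)) \<in> basic_set t (basicD (star t * t))"
  shows "nat_le s t"
proof -
  obtain \<eta> where "germ s (principal_char (star s * s)) = germ t \<eta>"
    using assms by (auto simp: basic_set_def)
  from germ_eqD[OF this principal_char_basicD] obtain u
    where u: "nat_le u s" "nat_le u t" "principal_char (star s * s) \<in> basicD (star u * u)"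
    by blast
  have "star s * s * (star u * u) = star s * s"
    using u(3) star_mult_idem[of u] by (simp add: basicD_def principal_char_def)
  then have "u = s"
    by (rule nat_le_eqI[OF u(1)])
  then show ?thesis using u(2) by simp
qed

text \<open>If \<open>s\<close> is maximal in the support of \<open>a\<close>, the image of \<open>a\<close> takes the value \<open>a(s)\<close> at the germ of
  \<open>s\<close> at the principal character of \<open>s*s\<close>.\<close>

lemma sg_iso_eq_zero:
  assumes "sg_iso a = (\<lambda>_. 0)"
  shows "a = 0"
proof (rule ccontr)
  let ?K = "Poly_Mapping.keys a" and ?R = "\<lambda>s t. nat_le s t \<and> s \<noteq> t"
  assume "a \<noteq> 0"
  then have ne: "?K \<noteq> {}" by simp
  have "asymp_on ?K ?R" "transp_on ?K ?R"
    by (auto intro!: asymp_onI transp_onI dest: nat_le_antisym intro: nat_le_trans)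
  then obtain s where s: "s \<in> ?K" "\<And>t. t \<in> ?K \<Longrightarrow> \<not> ?R s t"
    using Finite_Set.bex_max_element[of ?K ?R] ne finite_keys by metis
  have "germ s (principal_char (star s * s)) \<in> basic_set s (basicD (star s * s))"
    using principal_char_basicD by (auto simp: basic_set_def)
  moreover have "germ s (principal_char (star s * s)) \<notin> basic_set t (basicD (star t * t))"
    if "t \<in> ?K" "t \<noteq> s" for t
    using s(2) that principal_germ_in_basic_set by blast
  ultimately have sum: "Poly_Mapping.lookup a t * indicator (basic_set t (basicD (star t * t)))
      (germ s (principal_char (star s * s))) = (if t = s then Poly_Mapping.lookup a t else 0)"
    if "t \<in> ?K" for t
    using that by (auto simp: indicator_def)
  have "0 = sg_iso a (germ s (principal_char (star s * s)))"
    using assms by simp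
  also have "\<dots> = (\<Sum>t\<in>?K. (if t = s then Poly_Mapping.lookup a t else 0))"
    unfolding sg_iso_def by (intro sum.cong refl sum)
  also have "\<dots> = Poly_Mapping.lookup a s"
    using s(1) by simp
  finally show False using s(1) by (simp add: in_keys_iff)
qed

lemma inj_sg_iso: "inj sg_iso"
proof (rule injI)
  fix a b :: "'a \<Rightarrow>\<^sub>0 'b" assume "sg_iso a = sg_iso b"
  then have "sg_iso (a - b) = (\<lambda>_. 0)" by (auto simp: sg_iso_diff)
  then show "a = b" using sg_iso_eq_zero[of "a - b"] by simp
qed

text \<open>This evaluates the action of the groupoid algebra:
  \<open>groupoid_act act (sg_iso a)\<close> is \<open>act a\<close>.\<close>

lemma inv_sg_iso: "inv_into UNIV sg_iso (sg_iso a) = a"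
  by (simp add: inj_sg_iso)

section \<open>Characteristic functions of compact open sets\<close>

lemma sg_iso_idem:
  assumes "Poly_Mapping.keys a \<subseteq> idems"
  shows "sg_iso a x = (\<Sum>e\<in>Poly_Mapping.keys a. Poly_Mapping.lookup a e * indicator (units (basicD e)) x)"
  unfolding sg_iso_def
  by (intro sum.cong refl) (simp add: basic_set_idem subsetD[OF assms])

lemma keys_sum_subset: "(\<And>i. i \<in> A \<Longrightarrow> Poly_Mapping.keys (f i) \<subseteq> B) \<Longrightarrow> Poly_Mapping.keys (sum f A) \<subseteq> B"
  by (induction A rule: infinite_finite_induct)
    (auto dest!: subsetD[OF Poly_Mapping.keys_add])

lemma keys_sg_mult_idem:
  assumes "Poly_Mapping.keys a \<subseteq> idems" "Poly_Mapping.keys b \<subseteq> idems"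
  shows "Poly_Mapping.keys (sg_mult a b) \<subseteq> idems"
  unfolding sg_mult_def using assms by (intro keys_sum_subset) (auto intro: idems_mult)

text \<open>On combinations of idempotents the product becomes pointwise, because D(ef) is the
  intersection of D(e) and D(f).\<close>

lemma sg_iso_mult_idem:
  assumes "Poly_Mapping.keys a \<subseteq> idems" "Poly_Mapping.keys b \<subseteq> idems"
  shows "sg_iso (sg_mult a b) x = sg_iso a x * sg_iso b x"
  unfolding sg_mult_def sg_iso_sum sg_iso_single sg_iso_idem[OF assms(1)] sg_iso_idem[OF assms(2)]
    sum_product
proof (intro sum.cong refl)
  fix s t assume "s \<in> Poly_Mapping.keys a" "t \<in> Poly_Mapping.keys b"
  then have st: "s \<in> idems" "t \<in> idems" using assms by auto
  show "Poly_Mapping.lookup a s * Poly_Mapping.lookup b t *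
      indicator (basic_set (s * t) (basicD (star (s * t) * (s * t)))) x =
    Poly_Mapping.lookup a s * indicator (units (basicD s)) x *
      (Poly_Mapping.lookup b t * indicator (units (basicD t)) x)"
    using st
    by (auto simp: basic_set_idem idems_mult basicD_mult units_Int indicator_def)
qed

text \<open>Such an a acts as the characteristic function of U. Its support consists of idempotents,
  so that products are pointwise and its action on a common eigenvector of the idempotents can be
  computed.\<close>

definition represents :: "('s::inverse_semigroup \<Rightarrow>\<^sub>0 'k::comm_ring_1) \<Rightarrow> ('s \<Rightarrow> bool) set \<Rightarrow> bool" where
  "represents a U \<longleftrightarrow> Poly_Mapping.keys a \<subseteq> idems \<and> sg_iso a = indicator (units U)"

lemma represents_empty: "represents 0 {}"
  by (auto simp: represents_def sg_iso_zero units_def)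

lemma represents_basicD: "e \<in> idems \<Longrightarrow> represents (sg_elem e) (basicD e)"
  by (auto simp: represents_def sg_iso_single basic_set_idem)

lemma represents_Int:
  "represents a U \<Longrightarrow> represents b V \<Longrightarrow> represents (sg_mult a b) (U \<inter> V)"
  by (auto simp: represents_def keys_sg_mult_idem[THEN subsetD] sg_iso_mult_idem units_Int
      indicator_inter_arith)

text \<open>The characteristic function of U - V is that of U minus the product of those of U and
  V.\<close>

lemma represents_Diff:
  assumes "represents a U" "represents b V"
  shows "represents (a - sg_mult a b) (U - V)"
proof -
  have "Poly_Mapping.keys (a - sg_mult a b) \<subseteq> idems"
    using assms keys_sg_mult_idem[of a b] keys_diff[of a "sg_mult a b"]
    by (auto simp: represents_def)
  then show ?thesis
    using assms
    by (auto simp: represents_def sg_iso_diff sg_iso_mult_idem units_Diff indicator_def fun_eq_iff)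
qed

lemma represents_Un:
  assumes "represents a U" "represents b V"
  shows "represents (a - sg_mult a b + b) (U \<union> V)"
proof -
  have d: "represents (a - sg_mult a b) (U - V)"
    using represents_Diff[OF assms] .
  have "Poly_Mapping.keys (a - sg_mult a b + b) \<subseteq> idems"
    using assms(2) d Poly_Mapping.keys_add[of "a - sg_mult a b" b]
    by (auto simp: represents_def)
  then show ?thesis
    using assms d
    by (auto simp: represents_def sg_iso_add units_Diff units_Un indicator_def fun_eq_iff)
qed

lemma represents_Union:
  assumes "finite \<F>" "\<And>U. U \<in> \<F> \<Longrightarrow> \<exists>a::'s::inverse_semigroup \<Rightarrow>\<^sub>0 'k::comm_ring_1. represents a U"
  shows "\<exists>a::'s \<Rightarrow>\<^sub>0 'k. represents a (\<Union>\<F>)"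
  using assms
proof (induction \<F>)
  case empty
  then show ?case using represents_empty by auto
next
  case (insert U \<F>)
  then show ?case using represents_Un by (metis Union_insert insertCI)
qed

section \<open>Topology of the spectrum and its compact open sets\<close>

lemma clopen_coordinate:
  fixes e :: "'s::inverse_semigroup"
  assumes "e \<in> idems"
  defines "X \<equiv> product_topology (\<lambda>_::'s. discrete_topology (UNIV::bool set)) idems"
  shows "openin X {\<theta> \<in> topspace X. \<theta> e}" "closedin X {\<theta> \<in> topspace X. \<theta> e}"
proof -
  have "continuous_map X (discrete_topology UNIV) (\<lambda>\<theta>. \<theta> e)"
    unfolding X_def using assms continuous_map_product_projection by metis
  from openin_continuous_map_preimage[OF this, of "{True}"]
    closedin_continuous_map_preimage[OF this, of "{True}"]
  show "openin X {\<theta> \<in> topspace X. \<theta> e}" "closedin X {\<theta> \<in> topspace X. \<theta> e}" by auto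
qed

lemma topspace_spectrum_top: "topspace spectrum_top = spectrum"
  by (auto simp: spectrum_top_def spectrum_def PiE_UNIV_domain PiE_def)

lemma basicD_clopen:
  assumes "e \<in> idems"
  shows "openin spectrum_top (basicD e)" "closedin spectrum_top (basicD e)"
proof -
  have "basicD e = {\<theta> \<in> topspace (product_topology (\<lambda>_. discrete_topology UNIV) idems). \<theta> e} \<inter> spectrum"
    by (auto simp: basicD_def spectrum_def PiE_def)
  then show "openin spectrum_top (basicD e)" "closedin spectrum_top (basicD e)"
    unfolding spectrum_top_def openin_subtopology closedin_subtopology
    using clopen_coordinate[OF assms] by blast+
qed

text \<open>Multiplicativity is a closed condition in the compact product. Being non-zero is not
  closed in general, but follows here from \<theta>(e) = 1, so D(e) is closed in the
  product.\<close>

lemma compactin_basicD: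
  fixes e :: "'s::inverse_semigroup"
  assumes "e \<in> idems"
  shows "compactin spectrum_top (basicD e)"
proof -
  define X where "X = product_topology (\<lambda>_::'s. discrete_topology (UNIV::bool set)) idems"
  define A where "A f = {\<theta> \<in> topspace X. \<theta> f}" for f
  \<comment> \<open>The points with \<theta>(fg) = \<theta>(f)\<theta>(g), split by the common value
    1 or 0 so that closedness is visible.\<close>
  define B where "B f g = (A (f * g) \<inter> (A f \<inter> A g)) \<union>
      (topspace X - A (f * g)) \<inter> (topspace X - A f \<inter> A g)" for f g
  have A: "openin X (A f)" "closedin X (A f)" if "f \<in> idems" for f
    using clopen_coordinate[OF that] by (auto simp: A_def X_def)
  have B: "closedin X (B f g)" if "f \<in> idems" "g \<in> idems" for f g
    unfolding B_def using that
    by (intro closedin_Un closedin_Int closedin_diff openin_Int A idems_mult) auto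
  have X: "topspace X = extensional idems"
    by (auto simp: X_def PiE_def)
  have "basicD e = A e \<inter> (\<Inter>(f, g)\<in>idems \<times> idems. B f g)"
    using assms by (auto simp: basicD_def spectrum_def A_def B_def X)
  moreover have "closedin X \<dots>"
    using assms B by (intro closedin_Int A closedin_Inter) auto
  moreover have "compact_space X"
    by (simp add: X_def compact_space_product_topology compact_space_discrete_topology)
  ultimately have "compactin X (basicD e)"
    by (metis closedin_compact_space)
  then show ?thesis
    by (simp add: spectrum_top_def X_def compactin_subtopology basicD_subset)
qed

lemma compactin_basicD_Diff:
  assumes "e \<in> idems" "f \<in> idems"
  shows "compactin spectrum_top (basicD f - basicD e)"
proof -
  have "basicD f - basicD e = (topspace spectrum_top - basicD e) \<inter> basicD f"
    using basicD_subset by (auto simp: topspace_spectrum_top)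
  then show ?thesis
    using closed_Int_compactin[OF closedin_diff[OF closedin_topspace basicD_clopen(1)[OF assms(1)]]
        compactin_basicD[OF assms(2)]] by simp
qed

text \<open>Each condition on a coordinate j intersects with D(j) or removes D(j). The induction
  starts from D(e), since the whole spectrum may fail to be represented.\<close>

lemma represents_cylinder:
  fixes \<theta> :: "'s::inverse_semigroup \<Rightarrow> bool"
  assumes "finite J" "J \<subseteq> idems" "e \<in> idems"
  shows "openin spectrum_top {\<eta> \<in> basicD e. \<forall>j\<in>J. \<eta> j = \<theta> j} \<and>
    (\<exists>a::'s \<Rightarrow>\<^sub>0 'k::comm_ring_1. represents a {\<eta> \<in> basicD e. \<forall>j\<in>J. \<eta> j = \<theta> j})"
  using assms(1,2)
proof (induction J)
  case empty
  then show ?case using assms(3) basicD_clopen represents_basicD by auto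
next
  case (insert j J)
  let ?C = "{\<eta> \<in> basicD e. \<forall>j\<in>J. \<eta> j = \<theta> j}"
  have j: "j \<in> idems" using insert by simp
  have eq: "{\<eta> \<in> basicD e. \<forall>j\<in>insert j J. \<eta> j = \<theta> j} =
      (if \<theta> j then ?C \<inter> basicD j else ?C - basicD j)"
    using basicD_subset by (auto simp: basicD_def)
  have "openin spectrum_top ?C" "\<exists>a::'s \<Rightarrow>\<^sub>0 'k. represents a ?C"
    using insert by auto
  moreover note basicD_clopen[OF j] represents_basicD[OF j, where ?'b = 'k]
  ultimately show ?case
    unfolding eq
    by (auto intro!: openin_Int openin_diff intro: represents_Int represents_Diff)
qed

text \<open>Every point of U has a cylinder neighbourhood inside U; by compactness finitely many of
  them cover U, and their union is U.\<close>

lemma represents_compact_open: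
  fixes U :: "('s::inverse_semigroup \<Rightarrow> bool) set"
  assumes "openin spectrum_top U" "compactin spectrum_top U"
  shows "\<exists>a::'s \<Rightarrow>\<^sub>0 'k::comm_ring_1. represents a U"
proof -
  let ?good = "\<lambda>C. openin spectrum_top C \<and> C \<subseteq> U \<and> (\<exists>a::'s \<Rightarrow>\<^sub>0 'k. represents a C)"
  have nbhd: "\<exists>C. ?good C \<and> \<theta> \<in> C" if "\<theta> \<in> U" for \<theta>
  proof -
    obtain T where T: "openin (product_topology (\<lambda>_. discrete_topology UNIV) idems) T"
      "U = T \<inter> spectrum"
      using assms(1) by (auto simp: spectrum_top_def openin_subtopology)
    from T(1) have "\<forall>x\<in>T. \<exists>W. finite {i \<in> idems. W i \<noteq> UNIV} \<and> x \<in> Pi\<^sub>E idems W \<and> Pi\<^sub>E idems W \<subseteq> T"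
      by (simp add: openin_product_topology_alt)
    moreover have "\<theta> \<in> T" using that T(2) by simp
    ultimately obtain W where W: "finite {i \<in> idems. W i \<noteq> UNIV}"
      "\<theta> \<in> Pi\<^sub>E idems W" "Pi\<^sub>E idems W \<subseteq> T"
      by blast
    \<comment> \<open>The coordinates actually restricted by the box W: agreeing with \<theta> on
      them suffices to lie in W.\<close>
    define J where "J = {i \<in> idems. W i \<noteq> UNIV}"
    have \<theta>: "\<theta> \<in> spectrum" using that T by auto
    then obtain e where e: "e \<in> idems" "\<theta> e" by (auto simp: spectrum_def)
    let ?C = "{\<eta> \<in> basicD e. \<forall>j\<in>J. \<eta> j = \<theta> j}"
    have "?C \<subseteq> U"
    proof
      fix \<eta> assume \<eta>: "\<eta> \<in> ?C"
      then have \<eta>s: "\<eta> \<in> spectrum" using basicD_subset by auto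
      have "\<eta> i \<in> W i" if "i \<in> idems" for i
      proof (cases "i \<in> J")
        case True
        then show ?thesis using \<eta> W(2) that by (auto simp: PiE_iff)
      next
        case False
        then show ?thesis using that by (auto simp: J_def)
      qed
      then have "\<eta> \<in> Pi\<^sub>E idems W" using \<eta>s by (auto simp: PiE_iff spectrum_def)
      then show "\<eta> \<in> U" using W(3) T(2) \<eta>s by auto
    qed
    moreover have "finite J" "J \<subseteq> idems" using W(1) by (auto simp: J_def)
    moreover have "\<theta> \<in> ?C" using \<theta> e by (auto simp: basicD_def)
    ultimately show ?thesis
      using represents_cylinder[of J e \<theta>, where ?'k = 'k] e(1) by blast
  qed
  have "U \<subseteq> \<Union>{C. ?good C}" using nbhd by auto
  then obtain \<F> where \<F>: "finite \<F>" "\<F> \<subseteq> {C. ?good C}" "U \<subseteq> \<Union>\<F>"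
    using compactinD[OF assms(2), of "{C. ?good C}"] by auto
  then have "U = \<Union>\<F>" by auto
  moreover have "\<exists>a::'s \<Rightarrow>\<^sub>0 'k. represents a (\<Union>\<F>)"
    using \<F> by (intro represents_Union) auto
  ultimately show ?thesis by simp
qed

lemma groupoid_act_represents:
  assumes "represents a U"
  shows "groupoid_act act (indicator (units U)) = act a"
  using assms inv_sg_iso[of a] by (simp add: groupoid_act_def represents_def)

section \<open>Spectral modules\<close>

lemma sg_mult_single:
  "sg_mult (Poly_Mapping.single s c) (Poly_Mapping.single t d) = Poly_Mapping.single (s * t) (c * d)"
  by (cases "c = 0"; cases "d = 0") (simp_all add: sg_mult_def lookup_single)

lemma sum_single_lookup: "(\<Sum>s\<in>Poly_Mapping.keys a. Poly_Mapping.single s (Poly_Mapping.lookup a s)) = a"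
  by (rule poly_mapping_eqI) (auto simp: lookup_sum lookup_single when_def in_keys_iff)

lemma sg_scale_single: "sg_scale k (sg_elem s) = Poly_Mapping.single s k"
  by (rule poly_mapping_eqI) (auto simp: sg_scale_def map.rep_eq lookup_single when_def)

context semigroup_algebra_module
begin

lemma act_zero_left: "act 0 v = 0"
  using act_add_left[of 0 0 v] by simp

lemma act_zero_right: "act a 0 = 0"
  using act_add_right[of a 0 0] by simp

lemma act_diff_left: "act (a - b) v = act a v - act b v"
  using act_add_left[of "a - b" b v] by (simp add: algebra_simps)

lemma act_diff_right: "act a (v - w) = act a v - act a w"
  using act_add_right[of a "v - w" w] by (simp add: algebra_simps)

lemma act_elem_mult: "act (sg_elem (s * t)) v = act (sg_elem s) (act (sg_elem t) v)"
  using act_mult[of "sg_elem s" "sg_elem t" v] by (simp add: sg_mult_single)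

lemma act_sum_left: "act (sum f A) v = (\<Sum>i\<in>A. act (f i) v)"
  by (induction A rule: infinite_finite_induct) (simp_all add: act_zero_left act_add_left)

lemma act_eq_sum:
  "act a v = (\<Sum>s\<in>Poly_Mapping.keys a. scale (Poly_Mapping.lookup a s) (act (sg_elem s) v))"
proof -
  have "act a v = act (\<Sum>s\<in>Poly_Mapping.keys a. Poly_Mapping.single s (Poly_Mapping.lookup a s)) v"
    by (simp only: sum_single_lookup)
  also have "\<dots> = (\<Sum>s\<in>Poly_Mapping.keys a. act (sg_scale (Poly_Mapping.lookup a s) (sg_elem s)) v)"
    by (simp add: act_sum_left sg_scale_single)
  finally show ?thesis by (simp add: act_scale_left)
qed

lemma act_elem_idem: "e \<in> idems \<Longrightarrow> act (sg_elem e) (act (sg_elem e) v) = act (sg_elem e) v"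
  by (simp add: idems_def flip: act_elem_mult)

lemma act_elem_commute:
  "e \<in> idems \<Longrightarrow> f \<in> idems \<Longrightarrow>
    act (sg_elem e) (act (sg_elem f) v) = act (sg_elem f) (act (sg_elem e) v)"
  by (metis act_elem_mult idems_commute)

text \<open>A vector of \<open>Res\<close> is in the range of each represented compact open
  neighbourhood of \<theta>. For D(e) this is the range of the idempotent operator e, which fixes
  it.\<close>

lemma Res_eigenvector:
  assumes \<theta>: "\<theta> \<in> spectrum" and v: "v \<in> Res (groupoid_act act) \<theta>" and e: "e \<in> idems"
  shows "act (sg_elem e) v = (if \<theta> e then v else 0)"
proof -
  have range: "v \<in> range (act a)"
    if "represents a U" "openin spectrum_top U" "compactin spectrum_top U" "\<theta> \<in> U" for a U
    using v that groupoid_act_represents[OF that(1), of act] unfolding Res_def by auto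
  show ?thesis
  proof (cases "\<theta> e")
    case True
    then have "v \<in> range (act (sg_elem e))"
      using \<theta> e basicD_clopen compactin_basicD represents_basicD
      by (intro range[of _ "basicD e"]) (auto simp: basicD_def)
    then show ?thesis using True act_elem_idem[OF e] by auto
  next
    case False
    obtain f where f: "f \<in> idems" "\<theta> f" using \<theta> by (auto simp: spectrum_def)
    \<comment> \<open>The element f - fe represents D(f) - D(e), a neighbourhood of \<theta>, and e
      annihilates its range.\<close>
    have "v \<in> range (act (sg_elem f - sg_mult (sg_elem f) (sg_elem e)))"
      using \<theta> e f False basicD_clopen compactin_basicD_Diff
      by (intro range[of _ "basicD f - basicD e"] represents_Diff represents_basicD openin_diff)
        (auto simp: basicD_def)
    then obtain w where "v = act (sg_elem f) w - act (sg_elem f) (act (sg_elem e) w)"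
      by (auto simp: act_diff_left act_mult)
    then show ?thesis
      using False by (simp add: act_diff_right act_elem_commute[OF e f(1)] act_elem_idem[OF e])
  qed
qed

lemma eigenvector_mem_Res:
  assumes \<theta>: "\<theta> \<in> spectrum"
    and v: "\<And>e. e \<in> idems \<Longrightarrow> act (sg_elem e) v = (if \<theta> e then v else 0)"
  shows "v \<in> Res (groupoid_act act) \<theta>"
proof -
  have "v \<in> range (groupoid_act act (indicator (units U)))"
    if U: "openin spectrum_top U" "compactin spectrum_top U" "\<theta> \<in> U" for U
  proof -
    obtain a :: "'s \<Rightarrow>\<^sub>0 'k" where a: "represents a U"
      using represents_compact_open[OF U(1,2)] by auto
    then have keys: "Poly_Mapping.keys a \<subseteq> idems" by (simp add: represents_def)
    obtain f where f: "f \<in> idems" "\<theta> \<in> basicD f"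
      using \<theta> by (auto simp: spectrum_def basicD_def)
    \<comment> \<open>\<open>germ f \<theta>\<close> is the unit at \<theta>, so this coefficient is
      a(e)\<theta>(e); their sum is the value of \<open>sg_iso a\<close> there, namely 1.\<close>
    let ?c = "\<lambda>e. Poly_Mapping.lookup a e * indicator (units (basicD e)) (germ f \<theta>)"
    have "act a v = (\<Sum>e\<in>Poly_Mapping.keys a. scale (?c e) v)"
      unfolding act_eq_sum[of a v]
    proof (intro sum.cong refl)
      fix e assume "e \<in> Poly_Mapping.keys a"
      then have "e \<in> idems" using keys by auto
      then show "scale (Poly_Mapping.lookup a e) (act (sg_elem e) v) = scale (?c e) v"
        using \<theta> by (auto simp: v germ_in_units_iff[OF f] indicator_def basicD_def)
    qed
    also have "\<dots> = scale (sg_iso a (germ f \<theta>)) v"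
      by (simp only: scale_sum_left sg_iso_idem[OF keys])
    also have "sg_iso a (germ f \<theta>) = 1"
      using a U(3) by (simp add: represents_def germ_in_units_iff[OF f])
    finally have "act a v = v" by simp
    then show ?thesis
      by (metis groupoid_act_represents[OF a] rangeI)
  qed
  then show ?thesis by (auto simp: Res_def)
qed

lemma spectral_iff_eigenvector:
  "spectral (groupoid_act act) \<longleftrightarrow>
    (\<exists>v. (\<exists>f\<in>idems. act (sg_elem f) v = v) \<and>
      (\<forall>e\<in>idems. act (sg_elem e) v \<noteq> 0 \<longleftrightarrow> act (sg_elem e) v = v))" (is "_ \<longleftrightarrow> ?R")
proof
  assume "spectral (groupoid_act act)"
  then obtain \<theta> where \<theta>: "\<theta> \<in> spectrum" "Res (groupoid_act act) \<theta> \<noteq> {0}"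
    by (auto simp: spectral_def)
  \<comment> \<open>With 0 in \<open>Res\<close>, being different from \<open>{0}\<close> means
    having a non-zero element.\<close>
  have "0 \<in> Res (groupoid_act act) \<theta>"
    by (rule eigenvector_mem_Res[OF \<theta>(1)]) (simp add: act_zero_right)
  then obtain v where v: "v \<in> Res (groupoid_act act) \<theta>" "v \<noteq> 0"
    using \<theta>(2) by blast
  note eig = Res_eigenvector[OF \<theta>(1) v(1)]
  obtain f where "f \<in> idems" "\<theta> f" using \<theta>(1) by (auto simp: spectrum_def)
  then show ?R
    using eig v(2) by (intro exI[of _ v]) auto
next
  assume ?R
  then obtain v f where f: "f \<in> idems" "act (sg_elem f) v = v"
    and v: "\<And>e. e \<in> idems \<Longrightarrow> act (sg_elem e) v \<noteq> 0 \<longleftrightarrow> act (sg_elem e) v = v"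
    by auto
  \<comment> \<open>For v = 0 the equivalence at f would fail: 0 = v holds while 0 is not
    non-zero.\<close>
  have "v \<noteq> 0" using v[OF f(1)] f(2) by auto
  define \<theta> where "\<theta> = restrict (\<lambda>e. act (sg_elem e) v = v) idems"
  \<comment> \<open>Either gv = v and (eg)v = ev, or gv = 0 and (eg)v = 0, which differs from
    v.\<close>
  have "\<theta> (e * g) \<longleftrightarrow> \<theta> e \<and> \<theta> g" if "e \<in> idems" "g \<in> idems" for e g
    using that idems_mult[OF that] \<open>v \<noteq> 0\<close> v[of e] v[of g] act_zero_right
    by (auto simp: \<theta>_def act_elem_mult)
  then have \<theta>: "\<theta> \<in> spectrum"
    using f by (auto simp: spectrum_def \<theta>_def)
  have "v \<in> Res (groupoid_act act) \<theta>"
    using v by (intro eigenvector_mem_Res[OF \<theta>]) (auto simp: \<theta>_def)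
  then show "spectral (groupoid_act act)"
    using \<theta> \<open>v \<noteq> 0\<close> by (auto simp: spectral_def)
qed

section \<open>Primitive idempotents and the descending chain condition\<close>

lemma primitive_imp_spectral:
  assumes "primitive_in (sg_rep act ` idems) p"
  shows "spectral (groupoid_act act)"
proof -
  obtain f where f: "f \<in> idems" "p = sg_rep act f"
    using assms by (auto simp: primitive_in_def)
  obtain w where w: "p w \<noteq> 0" using assms by (auto simp: primitive_in_def)
  \<comment> \<open>The operator of ef lies below p and is non-zero at w, so primitivity makes it
    equal to p.\<close>
  have ev: "act (sg_elem e) (p w) = p w" if "e \<in> idems" "act (sg_elem e) (p w) \<noteq> 0" for e
  proof -
    let ?q = "sg_rep act (e * f)"
    have q: "?q x = act (sg_elem e) (p x)" for x
      by (simp add: sg_rep_def act_elem_mult f(2))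
    have "?q \<in> sg_rep act ` idems" using idems_mult that f by auto
    moreover have "?q \<noteq> (\<lambda>_. 0)" using q that(2) by metis
    moreover have "op_le ?q p"
      using f by (auto simp: op_le_def q fun_eq_iff) (simp add: sg_rep_def act_elem_idem)
    ultimately have "?q = p" using assms by (auto simp: primitive_in_def)
    then show ?thesis using q by metis
  qed
  moreover have "act (sg_elem f) (p w) = p w"
    using f by (simp add: sg_rep_def act_elem_idem)
  ultimately show ?thesis
    unfolding spectral_iff_eigenvector using w f(1) by metis
qed

text \<open>Since s is \<open>s * star s * s\<close>, it acts as zero once the idempotent
  \<open>s * star s\<close> does. If all idempotents did, the whole algebra would act as zero,
  against non-degeneracy.\<close>

lemma exists_nonzero_idempotent:
  fixes w :: 'v
  assumes "w \<noteq> 0"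
  shows "\<exists>e\<in>idems. sg_rep act e \<noteq> (\<lambda>_. 0)"
proof (rule ccontr)
  assume "\<not> ?thesis"
  then have zero: "act (sg_elem e) v = 0" if "e \<in> idems" for e v
    using that by (auto simp: sg_rep_def fun_eq_iff)
  have "act (sg_elem s) v = 0" for s v
    using zero[OF mult_star_idem, of s "act (sg_elem s) v"]
    by (simp add: star_inverse flip: act_elem_mult)
  then have "act a v = 0" for a v by (simp add: act_eq_sum[of a])
  then have "{act a v |a v. True} = {0}" by auto
  then have "UNIV = span {0}" using nondegenerate by simp
  also have "span {0} = {0}" by simp
  finally show False using assms by blast
qed

text \<open>Without a primitive idempotent every non-zero one has a different non-zero one below it,
  and dependent choice builds an infinite descending chain.\<close>

lemma dcc_imp_primitive:
  fixes w :: 'v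
  assumes dcc: "descending_chain_condition (sg_rep act ` idems)" and "w \<noteq> 0"
  shows "\<exists>p. primitive_in (sg_rep act ` idems) p"
proof (rule ccontr)
  let ?P = "{p \<in> sg_rep act ` idems. p \<noteq> (\<lambda>_. 0)}"
  assume "\<nexists>p. primitive_in (sg_rep act ` idems) p"
  then have step: "\<exists>q. q \<in> ?P \<and> op_le q p \<and> q \<noteq> p" if "p \<in> ?P" for p
    using that unfolding primitive_in_def by blast
  obtain p where "p \<in> ?P" using exists_nonzero_idempotent[OF assms(2)] by auto
  then obtain c where "\<And>n. c n \<in> ?P \<and> op_le (c (Suc n)) (c n) \<and> c (Suc n) \<noteq> c n"
    using dependent_nat_choice[of "\<lambda>_ x. x \<in> ?P" "\<lambda>_ x y. op_le y x \<and> y \<noteq> x"] step by blast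
  then show False using dcc unfolding descending_chain_condition_def by blast
qed

end

theorem proposition6p33:
  fixes scale :: "'k::comm_ring_1 \<Rightarrow> 'v::ab_group_add \<Rightarrow> 'v"
    and act :: "('s::inverse_semigroup \<Rightarrow>\<^sub>0 'k) \<Rightarrow> 'v \<Rightarrow> 'v"
  assumes "semigroup_algebra_module scale act"
    and "\<exists>v::'v. v \<noteq> 0"
  shows "(spectral (groupoid_act act) \<longleftrightarrow>
           (\<exists>v. (\<exists>f\<in>idems. act (sg_elem f) v = v) \<and>
                (\<forall>e\<in>idems. act (sg_elem e) v \<noteq> 0 \<longleftrightarrow> act (sg_elem e) v = v)))
       \<and> ((\<exists>p. primitive_in (sg_rep act ` idems) p) \<longrightarrow> spectral (groupoid_act act))
       \<and> (descending_chain_condition (sg_rep act ` idems) \<longrightarrow>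
           (\<exists>p. primitive_in (sg_rep act ` idems) p))"
proof -
  interpret semigroup_algebra_module scale act by fact
  show ?thesis
    using spectral_iff_eigenvector primitive_imp_spectral dcc_imp_primitive assms(2) by blast
qed

end
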